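(* Let $q$ be a composite number. For $a\in(\mathbb Z/q\mathbb Z)\setminus\big((\mathbb Z/q\mathbb Z)^{\times}\cup\{0\}\big)$, let $r=q/\gcd(q,a)$. Consider two cellular automata: a $D$-dimensional $q$-state linear cellular automaton $((\mathbb Z/q\mathbb Z)^{\mathbb Z^D},T)$ and a $D$-dimensional $r$-state linear cellular automaton $((\mathbb Z/r\mathbb Z)^{\mathbb Z^D},T)$, having the same transition rule $T$. Then $$S_T(q,a)\cong S_T\big(r,\,a/\gcd(q,a)\big).$$
   Context: The dimension $D$ is any finite positive integer. For an integer $n\ge 2$, $\mathbb Z/n\mathbb Z=\{0,1,\dots,n-1\}$ is the additive group of residue classes of integers modulo $n$, and $(\mathbb Z/n\mathbb Z)^\times$ is the set of residue classes whose representative is relatively prime to $n$; $\gcd(q,a)$ is the greatest common divisor of $q$ and $a\in\{1,\dots,q-1\}$. Linear cellular automaton: let $m$ be a finite positive integer, $c_j\in\mathbb Z$ coefficients and $\boldsymbol v_j\in\mathbb Z^D$ vectors for $1\le j\le m$. The transition rule $T$ of a $D$-dimensional $n$-state linear cellular automaton $((\mathbb Z/n\mathbb Z)^{\mathbb Z^D},T)$ is given by $$(Tu)_{\boldsymbol i}=\sum_{j=1}^m c_j\,u_{\boldsymbol i+\boldsymbol v_j}\quad(\text{computed in }\mathbb Z/n\mathbb Z)$$ for $u=\{u_{\boldsymbol i}\}_{\boldsymbol i\in\mathbb Z^D}\in(\mathbb Z/n\mathbb Z)^{\mathbb Z^D}$. Automata with different numbers of states have the same transition rule $T$ when they are given by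 the same $m$, $c_j$, $\boldsymbol v_j$. $T^t$ is the $t$-fold composition of $T$, with $T^0u=u$. Single site seed: for $a\in(\mathbb Z/n\mathbb Z)\setminus\{0\}$, $u_{\langle a\rangle}\in(\mathbb Z/n\mathbb Z)^{\mathbb Z^D}$ is the configuration with $(u_{\langle a\rangle})_{\boldsymbol 0}=a$ and $(u_{\langle a\rangle})_{\boldsymbol i}=0$ for $\boldsymbol i\ne\boldsymbol 0$. The spatio-temporal pattern of the $n$-state automaton from the single site seed with $a$ is $\{T^tu_{\langle a\rangle}\}_{t=0}^\infty$. Isomorphic patterns: let $\Delta_T(n,a)$ be the subset of $\mathbb Z/n\mathbb Z$ consisting of those $b$ for which there exists $(\boldsymbol i,t)\in\mathbb Z^D\times\mathbb Z_{\ge0}$ with $(T^tu_{\langle a\rangle})_{\boldsymbol i}=b$. For $n,\hat n\ge2$, a $D$-dimensional $n$-state and a $D$-dimensional $\hat n$-state linear cellular automaton with the same transition rule $T$, and seeds $a\in(\mathbb Z/n\mathbb Z)\setminus\{0\}$, $\hat a\in(\mathbb Z/\hat n\mathbb Z)\setminus\{0\}$: if there exists an isomorphism $f:\Delta_T(n,a)\to\Delta_T(\hat n,\hat a)$ such that $f\big((T^tu_{\langle a\rangle})_{\boldsymbol i}\big)=(T^tu_{\langle\hat a\rangle})_{\boldsymbol i}$ for any site $\boldsymbol i\in\mathbb Z^D$ and any time step $t\in\mathbb Z_{\ge0}$, then the patterns $\{T^tu_{\langle a\rangle}\}_{t=0}^\infty$ and $\{T^tu_{\langle\hat a\rangle}\}_{t=0}^\infty$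 are called isomorphic, and this relationship is denoted $S_T(n,a)\cong S_T(\hat n,\hat a)$. (The definition uses the word "isomorphism" for the map $f$ between these subsets without further specification.) *)

theory Defs
  imports "HOL-Number_Theory.Residues" "HOL-Analysis.Finite_Cartesian_Product"
begin

text \<open>
  The residue classes modulo \<open>n\<close> are their representatives \<open>{0..n - 1}\<close>, that is,
  \<open>carrier (residue_ring n)\<close>. The lattice of dimension \<open>D = CARD('d)\<close> is the type
  \<open>int ^ 'd\<close>, and a transition rule is given by the data \<open>m\<close>, \<open>c\<close>, \<open>v\<close>
  (indices \<open>1, ..., m\<close>), which do not mention the number of states.
\<close>

definition residue_units :: "int \<Rightarrow> int set" where
  "residue_units n = {a \<in> carrier (residue_ring n). coprime a n}"

definition lca_step ::
    "nat \<Rightarrow> (nat \<Rightarrow> int) \<Rightarrow> (nat \<Rightarrow> int ^ 'd) \<Rightarrow> int \<Rightarrow> (int ^ 'd \<Rightarrow> int) \<Rightarrow> (int ^ 'd \<Rightarrow> int)" where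
  "lca_step m c v n u = (\<lambda>i. (\<Sum>j = 1..m. c j * u (i + v j)) mod n)"

definition single_site_seed :: "int \<Rightarrow> int ^ 'd \<Rightarrow> int" where
  "single_site_seed a = (\<lambda>i. if i = 0 then a else 0)"

definition pattern ::
    "nat \<Rightarrow> (nat \<Rightarrow> int) \<Rightarrow> (nat \<Rightarrow> int ^ 'd) \<Rightarrow> int \<Rightarrow> int \<Rightarrow> nat \<Rightarrow> int ^ 'd \<Rightarrow> int" where
  "pattern m c v n a t = (lca_step m c v n ^^ t) (single_site_seed a)"

definition pattern_values ::
    "nat \<Rightarrow> (nat \<Rightarrow> int) \<Rightarrow> (nat \<Rightarrow> int ^ 'd) \<Rightarrow> int \<Rightarrow> int \<Rightarrow> int set" where
  "pattern_values m c v n a = {b \<in> carrier (residue_ring n). \<exists>i t. pattern m c v n a t i = b}"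

text \<open>
  A set of values of a pattern need not be closed under addition, so it carries only the partial
  addition inherited from the ambient group of residue classes. An isomorphism between two
  such sets is a bijection that preserves and reflects this partial addition; on subgroups this is
  an isomorphism of groups.
\<close>

definition residue_subset_iso :: "int \<Rightarrow> int set \<Rightarrow> int \<Rightarrow> int set \<Rightarrow> (int \<Rightarrow> int) \<Rightarrow> bool" where
  "residue_subset_iso n A n' A' f \<longleftrightarrow>
     bij_betw f A A' \<and>
     (\<forall>x\<in>A. \<forall>y\<in>A.
        (x \<oplus>\<^bsub>residue_ring n\<^esub> y \<in> A \<longleftrightarrow> f x \<oplus>\<^bsub>residue_ring n'\<^esub> f y \<in> A') \<and>
        (x \<oplus>\<^bsub>residue_ring n\<^esub> y \<in> A \<longrightarrow>
           f (x \<oplus>\<^bsub>residue_ring n\<^esub> y) = f x \<oplus>\<^bsub>residue_ring n'\<^esub> f y))"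

text \<open>
  The first four conjuncts say that both patterns are meaningful: at least two states, and
  seeds that are nonzero residue classes.
\<close>

definition isomorphic_patterns ::
    "nat \<Rightarrow> (nat \<Rightarrow> int) \<Rightarrow> (nat \<Rightarrow> int ^ 'd) \<Rightarrow> int \<Rightarrow> int \<Rightarrow> int \<Rightarrow> int \<Rightarrow> bool" where
  "isomorphic_patterns m c v n a n' a' \<longleftrightarrow>
     n \<ge> 2 \<and> n' \<ge> 2 \<and>
     a \<in> carrier (residue_ring n) - {0} \<and> a' \<in> carrier (residue_ring n') - {0} \<and>
     (\<exists>f. residue_subset_iso n (pattern_values m c v n a) n' (pattern_values m c v n' a') f \<and>
          (\<forall>i t. f (pattern m c v n a t i) = pattern m c v n' a' t i))"

end

theory Submission imports Defs begin

text \<open>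
  Multiplication by \<open>g\<close> embeds the residues modulo \<open>r\<close> into those modulo \<open>g * r\<close> and commutes with
  every linear rule. With \<open>g = gcd q a\<close> the whole \<open>q\<close>-state pattern is therefore \<open>g\<close> times the
  \<open>r\<close>-state pattern, and the isomorphism is division by \<open>g\<close>.
\<close>

lemma lca_step_scale:
  "lca_step m c v (g * n) (\<lambda>i. g * u i) = (\<lambda>i. g * lca_step m c v n u i)"
proof -
  have "(\<Sum>j = 1..m. c j * (g * u (i + v j))) = g * (\<Sum>j = 1..m. c j * u (i + v j))" for i
    by (simp add: sum_distrib_left mult.left_commute)
  \<comment> \<open>The factor \<open>g\<close> passes through the reduction because
    \<open>(g * x) mod (g * n) = g * (x mod n)\<close>.\<close>
  then show ?thesis
    by (simp add: lca_step_def)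
qed

lemma pattern_scale:
  "pattern m c v (g * n) (g * a) t = (\<lambda>i. g * pattern m c v n a t i)"
proof (induction t)
  case 0
  show ?case by (auto simp: pattern_def single_site_seed_def)
next
  case (Suc t)
  then show ?case
    using lca_step_scale[of m c v g n "pattern m c v n a t"] by (simp add: pattern_def)
qed

lemma carrier_residue_ring: "carrier (residue_ring n) = {0..<n}"
  by (auto simp: residue_ring_def)

lemma pattern_values_scale:
  assumes "g > 0"
  shows "pattern_values m c v (g * n) (g * a) = (*) g ` pattern_values m c v n a"
proof -
  have "g * x \<in> {0..<g * n} \<longleftrightarrow> x \<in> {0..<n}" for x
    using assms by (simp add: zero_le_mult_iff)
  then show ?thesis
    unfolding pattern_values_def carrier_residue_ring pattern_scale by blast
qed

text \<open>Scaling by \<open>g\<close> is injective and additive from residues modulo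
  \<open>n\<close> to residues modulo \<open>g * n\<close>, so its inverse respects partial sums on
  any set \<open>B\<close>, closed under addition or not.\<close>

lemma residue_subset_iso_div:
  assumes "g > 0"
  shows "residue_subset_iso (g * n) ((*) g ` B) n B (\<lambda>x. x div g)"
proof -
  have "bij_betw (\<lambda>x. x div g) ((*) g ` B) B"
    using assms by (intro bij_betw_byWitness[where f' = "(*) g"]) auto
  moreover have "g * x \<oplus>\<^bsub>residue_ring (g * n)\<^esub> g * y = g * (x \<oplus>\<^bsub>residue_ring n\<^esub> y)" for x y
    by (simp add: residue_ring_def flip: distrib_left)
  \<comment> \<open>Injectivity of scaling makes a sum lie in one set exactly when its counterpart
    lies in the other.\<close>
  moreover have "g * x \<in> (*) g ` B \<longleftrightarrow> x \<in> B" for x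
    using assms by auto
  ultimately show ?thesis
    using assms by (simp add: residue_subset_iso_def)
qed

lemma isomorphic_patterns_scale:
  assumes "g > 0" and "n \<ge> 2" and "a \<in> {0<..<n}"
  shows "isomorphic_patterns m c v (g * n) (g * a) n a"
proof -
  have "g * n \<ge> 2"
    using assms(1,2) mult_mono[of 1 g 2 n] by simp
  moreover have "g * a \<in> {0<..<g * n}"
    using assms by simp
  moreover have "residue_subset_iso (g * n) (pattern_values m c v (g * n) (g * a)) n
      (pattern_values m c v n a) (\<lambda>x. x div g)"
    using assms(1) by (simp add: pattern_values_scale residue_subset_iso_div)
  moreover have "pattern m c v (g * n) (g * a) t i div g = pattern m c v n a t i" for i t
    using assms(1) by (simp add: pattern_scale)
  ultimately show ?thesis
    using assms(2,3)
    by (auto simp: isomorphic_patterns_def carrier_residue_ring intro!: exI[of _ "\<lambda>x. x div g"])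
qed

theorem lemma3:
  fixes q r a :: int
    and m :: nat and c :: "nat \<Rightarrow> int" and v :: "nat \<Rightarrow> int ^ 'd"
  assumes "q > 1" and "\<not> prime q"
    and "a \<in> carrier (residue_ring q) - (residue_units q \<union> {0})"
    and "r = q div gcd q a"
    and "m \<ge> 1"
  shows "isomorphic_patterns m c v q a r (a div gcd q a)"
proof -
  define g b where "g = gcd q a" and "b = a div g"
  have a: "0 < a" "a < q"
    using assms(3) by (auto simp: carrier_residue_ring)
  have g: "g > 0"
    using assms(1) by (simp add: g_def)
  have q_eq: "q = g * r" and a_eq: "a = g * b"
    by (simp_all add: assms(4) g_def b_def)
  \<comment> \<open>Cancelling \<open>g\<close> in \<open>0 < g * b < g * r\<close> makes
    \<open>b\<close> a nonzero residue modulo \<open>r\<close>; over the integers this also forces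
    \<open>r \<ge> 2\<close>.\<close>
  have "0 < b" "b < r"
    using a g unfolding q_eq a_eq by (simp_all add: zero_less_mult_iff)
  then have "isomorphic_patterns m c v (g * r) (g * b) r b"
    using g by (intro isomorphic_patterns_scale) auto
  then show ?thesis
    unfolding q_eq[symmetric] a_eq[symmetric] by (simp only: b_def g_def)
qed

end
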